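(* Let $p\in\mathcal{H}_1$ be such that $$\left|\frac{zp'(z)}{p(z)}\right|<\frac{\tanh 1}{2}\approx 0.380\ldots\qquad(z\in\mathbb{D}).$$ Then $p(z)\prec\cosh\sqrt z$.
   Context: $\mathbb{D}=\{z\in\mathbb{C}:|z|<1\}$. $\mathcal{H}_1$ is the class of analytic functions on $\mathbb{D}$ of the form $p(z)=1+a_1z+a_2z^2+\cdots$. For analytic functions $f,g$ on $\mathbb{D}$, $f\prec g$ means that $f(z)=g(w(z))$ for some analytic $w:\mathbb{D}\to\mathbb{D}$ with $w(0)=0$. The function $\cosh\sqrt z$ denotes the analytic function $\sum_{n=0}^\infty z^n/(2n)!$. *)

theory Defs
  imports "HOL-Complex_Analysis.Complex_Analysis"
begin

definition class_H1 :: "(complex \<Rightarrow> complex) set" where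
  "class_H1 = {p. p holomorphic_on ball 0 1 \<and> p 0 = 1}"

definition subordinate :: "(complex \<Rightarrow> complex) \<Rightarrow> (complex \<Rightarrow> complex) \<Rightarrow> bool"
    (infix "\<prec>\<^sub>s" 50) where
  "f \<prec>\<^sub>s g \<longleftrightarrow>
     (\<exists>w. w holomorphic_on ball 0 1 \<and> w ` ball 0 1 \<subseteq> ball 0 1 \<and> w 0 = 0 \<and>
          (\<forall>z\<in>ball 0 1. f z = g (w z)))"

text \<open>The entire function written \<open>cosh \<surd>z\<close>. Since \<open>cosh\<close> is even, the branch of the square root
  is immaterial; lemma \<open>cosh_sqrt_eq\<close> below uses the principal one.\<close>

definition cosh_sqrt :: "complex \<Rightarrow> complex" where
  "cosh_sqrt z = (\<Sum>n. z ^ n / fact (2 * n))"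

lemma cosh_sqrt_sums: "(\<lambda>n. z ^ n / fact (2 * n)) sums cosh (csqrt z)"
proof -
  let ?f = "\<lambda>n. if even n then csqrt z ^ n /\<^sub>R fact n else 0"
  have "?f sums cosh (csqrt z)"
    by (rule cosh_converges)
  moreover have "strict_mono (\<lambda>n::nat. 2 * n)"
    by (simp add: strict_mono_def)
  moreover have "?f n = 0" if "n \<notin> range (\<lambda>n. 2 * n)" for n
    using that by (auto elim!: evenE)
  ultimately have "(\<lambda>n. ?f (2 * n)) sums cosh (csqrt z)"
    using sums_mono_reindex[of "\<lambda>n. 2 * n" ?f] by blast
  moreover have "?f (2 * n) = z ^ n / fact (2 * n)" for n
  proof -
    have "csqrt z ^ (2 * n) = z ^ n"
      by (simp only: power_mult power2_csqrt)
    then show ?thesis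
      by (simp add: scaleR_conv_of_real field_simps)
  qed
  ultimately show ?thesis
    by simp
qed

lemma cosh_sqrt_eq: "cosh_sqrt z = cosh (csqrt z)"
  unfolding cosh_sqrt_def by (rule sums_unique[OF cosh_sqrt_sums, symmetric])

end

theory Submission
  imports Defs
begin

text \<open>The hypothesis keeps \<open>p\<close> away from \<open>0\<close>, so \<open>p = exp h\<close> with \<open>h 0 = 0\<close> and
  \<open>\<bar>z h'(z)\<bar> < c = tanh 1 / 2 < 2/5\<close>; by the Schwarz lemma \<open>\<bar>h'\<bar> \<le> c\<close>, whence \<open>\<bar>h\<bar> < 2/5\<close>.
  Comparing Taylor polynomials shows that \<open>cosh \<surd>z = exp h\<close> is impossible for
  \<open>\<bar>z\<bar> = 1\<close>, \<open>\<bar>h\<bar> < 2/5\<close>, so by connectedness \<open>exp\<close> maps the disc of radius \<open>2/5\<close> into the image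
  of the unit disc under the univalent function \<open>cosh \<surd>z\<close>, and inverting that function yields
  the subordinating map.\<close>

section \<open>Holomorphy and univalence of \<open>cosh_sqrt\<close>\<close>

lemma holomorphic_on_cosh_sqrt [holomorphic_intros]: "cosh_sqrt holomorphic_on A"
proof -
  have "cosh_sqrt holomorphic_on ball 0 (norm w + 1)" for w :: complex
  proof (rule power_series_holomorphic)
    show "(\<lambda>n. 1 / fact (2 * n) * (z - 0) ^ n) sums cosh_sqrt z" for z
      using cosh_sqrt_sums[of z] by (simp add: cosh_sqrt_eq)
  qed
  then have "cosh_sqrt field_differentiable at w" for w
    by (rule holomorphic_on_imp_differentiable_at[of _ "ball 0 (norm w + 1)"]) auto
  then show ?thesis
    by (auto simp: holomorphic_on_def intro: field_differentiable_at_within)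
qed

lemma cosh_eq_iff_exp_eq: "cosh a = cosh b \<longleftrightarrow> exp a = exp b \<or> exp a = exp (- b)"
  for a b :: complex
proof -
  have "2 * exp a * exp b * (cosh a - cosh b) = (exp a - exp b) * (exp a * exp b - 1)"
    by (simp add: cosh_def scaleR_conv_of_real exp_minus field_simps)
  moreover have "exp a * exp b = 1 \<longleftrightarrow> exp a = exp (- b)"
    by (simp add: exp_minus field_simps)
  ultimately show ?thesis
    by (metis exp_not_eq_zero mult_eq_0_iff right_minus_eq zero_neq_numeral)
qed

text \<open>The square roots lie in the unit disc, so the imaginary parts of \<open>csqrt x\<close>
  and of either sign of \<open>csqrt y\<close> differ by less than \<open>2 * pi\<close>. There
  \<open>exp\<close> is injective, so the roots agree up to sign and their squares coincide.\<close>

lemma inj_on_cosh_sqrt: "inj_on cosh_sqrt (ball 0 1)"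
proof (rule inj_onI)
  fix x y :: complex
  assume "x \<in> ball 0 1" "y \<in> ball 0 1" and eq: "cosh_sqrt x = cosh_sqrt y"
  then have "norm (csqrt x) < 1" "norm (csqrt y) < 1"
    by auto
  then have Im: "\<bar>Im (csqrt x)\<bar> < 1" "\<bar>Im (csqrt y)\<bar> < 1"
    using abs_Im_le_cmod order_le_less_trans by blast+
  have "exp (csqrt x) = exp (csqrt y) \<or> exp (csqrt x) = exp (- csqrt y)"
    using eq by (simp add: cosh_sqrt_eq cosh_eq_iff_exp_eq)
  then have "csqrt x = csqrt y \<or> csqrt x = - csqrt y"
    using Im pi_gt3 exp_complex_eqI[of "csqrt x" "csqrt y"] exp_complex_eqI[of "csqrt x" "- csqrt y"]
    by (smt (verit) uminus_complex.sel(2))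
  then show "x = y"
    by (metis power2_csqrt power2_minus)
qed

section \<open>Quadratic Taylor estimates and the image of the unit disc\<close>

lemma norm_exp_minus_quadratic_le:
  fixes h :: complex
  assumes "norm h \<le> 2/5"
  shows "norm (exp h - (1 + h + h\<^sup>2 / 2)) \<le> 3/125"
proof -
  have "exp (norm h) \<le> exp 1"
    using assms by simp
  also have "\<dots> \<le> (3::real)"
    by (rule exp_le)
  finally have e: "exp (norm h) \<le> 3" .
  define T where "T = (\<Sum>i\<le>3. h ^ i / fact i)"
  have T_eq: "T = 1 + h + h\<^sup>2 / 2 + h ^ 3 / 6"
    by (simp add: T_def atMost_nat_numeral fact_numeral)
  have "norm h ^ 3 \<le> (2/5) ^ 3" "norm h ^ 4 \<le> (2/5) ^ 4"
    by (intro power_mono assms norm_ge_zero)+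
  then have h3: "norm h ^ 3 \<le> 8/125" and h4: "norm h ^ 4 \<le> 16/625"
    by (simp_all add: power_divide)
  \<comment> \<open>The remainder bound for degree \<open>n\<close> divides by
    \<open>fact n\<close>, not \<open>fact (n + 1)\<close>; hence \<open>6\<close> here and
    \<open>5040\<close> for degree 7 below.\<close>
  have "norm (exp h - T) \<le> exp (norm h) * norm h ^ 4 / 6"
    using Taylor_exp_field[of h 3] by (simp add: T_def fact_numeral)
  also have "\<dots> \<le> 3 * (16/625) / 6"
    using e h4 by (intro divide_right_mono mult_mono) auto
  finally have T: "norm (exp h - T) \<le> 8/625"
    by simp
  have "norm (exp h - (1 + h + h\<^sup>2 / 2)) = norm ((exp h - T) + h ^ 3 / 6)"
    by (simp add: T_eq algebra_simps)
  also have "\<dots> \<le> norm (exp h - T) + norm (h ^ 3 / 6)"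
    by (rule norm_triangle_ineq)
  also have "norm (h ^ 3 / 6) = norm h ^ 3 / 6"
    by (simp add: norm_divide norm_power)
  finally show ?thesis
    using T h3 by simp
qed

text \<open>Averaging the degree-7 Taylor polynomials of \<open>exp\<close> at \<open>s\<close> and
  \<open>- s\<close>, with \<open>s ^ 2 = z\<close>, cancels the odd terms. The cubic term in
  \<open>z\<close> and the remainders leave \<open>1/720 + 3/5040 = 1/504\<close>.\<close>

lemma norm_cosh_sqrt_minus_quadratic_le:
  fixes z :: complex
  assumes "norm z = 1"
  shows "norm (cosh_sqrt z - (1 + z / 2 + z\<^sup>2 / 24)) \<le> 1/500"
proof -
  define s where "s = csqrt z"
  define T where "T = (\<lambda>x::complex. \<Sum>i\<le>7. x ^ i / fact i)"
  have T_eq: "T x = 1 + x + x ^ 2 / 2 + x ^ 3 / 6 + x ^ 4 / 24 + x ^ 5 / 120 + x ^ 6 / 720 + x ^ 7 / 5040"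
    for x
    by (simp add: T_def atMost_nat_numeral fact_numeral)
  have s2: "s ^ 2 = z" and s: "norm s = 1"
    by (simp_all add: s_def assms)
  have T: "norm (exp x - T x) \<le> 3 / 5040" if "norm x = 1" for x
  proof -
    have "norm (exp x - T x) \<le> exp 1 / 5040"
      using Taylor_exp_field[of x 7] that by (simp add: T_def fact_numeral)
    then show ?thesis
      using exp_le by linarith
  qed
  have "T s + T (- s) = 2 * (1 + z / 2 + z\<^sup>2 / 24 + z ^ 3 / 720)"
    by (simp add: T_eq flip: s2 power_mult)
  moreover have "2 * cosh_sqrt z = exp s + exp (- s)"
    by (simp add: cosh_sqrt_eq cosh_def scaleR_conv_of_real flip: s_def)
  ultimately have "2 * (cosh_sqrt z - (1 + z / 2 + z\<^sup>2 / 24))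
      = (exp s - T s) + (exp (- s) - T (- s)) + z ^ 3 / 360"
    by (simp add: algebra_simps)
  then have "2 * norm (cosh_sqrt z - (1 + z / 2 + z\<^sup>2 / 24))
      = norm ((exp s - T s) + (exp (- s) - T (- s)) + z ^ 3 / 360)"
    by (metis norm_mult norm_numeral)
  also have "\<dots> \<le> norm (exp s - T s) + norm (exp (- s) - T (- s)) + norm (z ^ 3 / 360)"
    by (intro norm_triangle_le add_mono order_refl norm_triangle_ineq)
  also have "norm (z ^ 3 / 360) = 1 / 360"
    using assms by (simp add: norm_divide norm_power)
  finally show ?thesis
    using T[of s] T[of "- s"] s by simp
qed

text \<open>With \<open>u = z / 2\<close>, equality would read \<open>u + u\<^sup>2/6 \<approx> h + h\<^sup>2/2\<close>, that is
  \<open>(u - h)(1 + (u + h)/6) \<approx> h\<^sup>2/3\<close>, whose left side is too large because \<open>\<bar>u\<bar> = 1/2\<close>.\<close>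

lemma cosh_sqrt_neq_exp:
  fixes z h :: complex
  assumes z: "norm z = 1" and h: "norm h \<le> 2/5"
  shows "cosh_sqrt z \<noteq> exp h"
proof
  assume eq: "cosh_sqrt z = exp h"
  define u where "u = z / 2"
  have u: "norm u = 1/2"
    using z by (simp add: u_def norm_divide)
  let ?A = "exp h - (1 + h + h\<^sup>2 / 2)" and ?B = "cosh_sqrt z - (1 + z / 2 + z\<^sup>2 / 24)"
  have "(u - h) * (1 + (u + h) / 6) = h\<^sup>2 / 3 + ?A - ?B"
    by (simp add: u_def eq field_simps power2_eq_square)
  also have "norm \<dots> \<le> norm (h\<^sup>2 / 3) + norm ?A + norm ?B"
    by (meson add_right_mono norm_triangle_ineq norm_triangle_ineq4 order_trans)
  also have "norm (h\<^sup>2 / 3) \<le> (2/5)\<^sup>2 / 3"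
    using power_mono[OF h norm_ge_zero, of 2] by (simp add: norm_divide norm_power)
  also have "norm ?A \<le> 3/125"
    by (rule norm_exp_minus_quadratic_le[OF h])
  also have "norm ?B \<le> 1/500"
    by (rule norm_cosh_sqrt_minus_quadratic_le[OF z])
  finally have "norm (u - h) * norm (1 + (u + h) / 6) \<le> (2/5)\<^sup>2 / 3 + 3/125 + 1/500"
    by (simp add: norm_mult)
  moreover have "1/10 \<le> norm (u - h)"
    using norm_triangle_ineq2[of u h] u h by simp
  moreover have "17/20 \<le> norm (1 + (u + h) / 6)"
  proof -
    have "norm ((u + h) / 6) \<le> 3/20"
      using norm_triangle_ineq[of u h] u h by (simp add: norm_divide)
    then show ?thesis
      using norm_diff_ineq[of 1 "(u + h) / 6"] by simp
  qed
  \<comment> \<open>The product of the lower bounds is \<open>0.085\<close>, while the upper bound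
    is less than \<open>0.08\<close>.\<close>
  ultimately show False
    using mult_mono[of "1/10" "norm (u - h)" "17/20" "norm (1 + (u + h) / 6)"]
    by (simp add: power2_eq_square)
qed

text \<open>The preimage \<open>T\<close> is clopen in the disc: open by the open mapping theorem,
  closed because passing to the compact closed unit disc adds no points, as
  \<open>cosh_sqrt_neq_exp\<close> excludes the unit circle.\<close>

lemma exp_ball_subset_cosh_sqrt_ball: "exp ` ball 0 (2/5) \<subseteq> cosh_sqrt ` ball 0 1"
proof -
  define T where "T = ball 0 (2/5) \<inter> exp -` (cosh_sqrt ` ball 0 1)"
  have cont: "continuous_on (ball 0 (2/5)) (exp :: complex \<Rightarrow> complex)"
    by (intro continuous_intros)
  have "open (cosh_sqrt ` ball 0 1)"
    by (rule open_mapping_thm3) (auto intro: holomorphic_intros inj_on_cosh_sqrt)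
  then have "openin (top_of_set (ball 0 (2/5))) T"
    unfolding T_def using cont continuous_openin_preimage_gen by blast
  moreover have "closedin (top_of_set (ball 0 (2/5))) T"
  proof -
    have "compact (cosh_sqrt ` cball 0 1)"
      by (intro compact_continuous_image holomorphic_on_imp_continuous_on holomorphic_intros) auto
    then have "closedin (top_of_set (ball 0 (2/5)))
        (ball 0 (2/5) \<inter> exp -` (cosh_sqrt ` cball 0 1))"
      using cont compact_imp_closed continuous_closedin_preimage by blast
    moreover have "T = ball 0 (2/5) \<inter> exp -` (cosh_sqrt ` cball 0 1)"
    proof
      show "ball 0 (2/5) \<inter> exp -` (cosh_sqrt ` cball 0 1) \<subseteq> T"
      proof
        fix h assume "h \<in> ball 0 (2/5) \<inter> exp -` (cosh_sqrt ` cball 0 1)"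
        then obtain z where h: "norm h < 2/5" and z: "norm z \<le> 1" and eq: "exp h = cosh_sqrt z"
          by auto
        have "norm z \<noteq> 1"
          using cosh_sqrt_neq_exp[of z h] h eq by auto
        with z h eq show "h \<in> T"
          by (auto simp: T_def)
      qed
    qed (auto simp: T_def)
    ultimately show ?thesis
      by simp
  qed
  moreover have "0 \<in> T"
  proof -
    have "exp 0 = cosh_sqrt 0"
      by (simp add: cosh_sqrt_eq)
    then show ?thesis
      unfolding T_def by (auto intro!: image_eqI[of _ _ 0])
  qed
  ultimately have "T = ball 0 (2/5)"
    using connected_clopen[of "ball 0 (2/5) :: complex set"] by auto
  then show ?thesis
    by (auto simp: T_def)
qed

section \<open>Consequences of a bound on the logarithmic derivative\<close>

lemma norm_diff_le_of_norm_times_deriv_less: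
  fixes h :: "complex \<Rightarrow> complex"
  assumes hol: "h holomorphic_on ball 0 1"
    and bound: "\<And>z. z \<in> ball 0 1 \<Longrightarrow> norm (z * deriv h z) < c"
    and z: "z \<in> ball 0 1"
  shows "norm (h z - h 0) \<le> c * norm z"
proof -
  have c: "c > 0"
    using bound[of 0] by simp
  define F where "F = (\<lambda>z. z * deriv h z / of_real c)"
  have hol': "deriv h holomorphic_on ball 0 1"
    by (intro holomorphic_deriv hol open_ball)
  have F: "F holomorphic_on ball 0 1"
    unfolding F_def using c by (intro holomorphic_intros hol') auto
  have F0: "F 0 = 0"
    by (simp add: F_def)
  have F1: "norm (F w) < 1" if "norm w < 1" for w
    using bound[of w] that c by (simp add: F_def norm_divide)
  have "norm (deriv h w) \<le> c" if "w \<in> ball 0 1" for w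
  proof (cases "w = 0")
    \<comment> \<open>Dividing \<open>F\<close> by \<open>w\<close> is impossible at the origin; the
      derivative part of the Schwarz lemma bounds \<open>deriv F 0\<close> instead.\<close>
    case True
    have "(deriv h has_field_derivative deriv (deriv h) 0) (at 0)"
      using holomorphic_derivI[OF hol'] by simp
    then have "(F has_field_derivative deriv h 0 / of_real c) (at 0)"
      unfolding F_def using c by (auto intro!: derivative_eq_intros)
    then have "deriv F 0 = deriv h 0 / of_real c"
      by (rule DERIV_imp_deriv)
    with Schwarz_Lemma(2)[OF F F0 F1, of 0] show ?thesis
      using c True by (simp add: norm_divide)
  next
    case False
    with Schwarz_Lemma(1)[OF F F0 F1, of w] that show ?thesis
      using c by (simp add: F_def norm_divide norm_mult pos_divide_le_eq)
  qed
  moreover have "(h has_field_derivative deriv h w) (at w within ball 0 1)" if "w \<in> ball 0 1" for w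
    using holomorphic_derivI[OF hol open_ball that] .
  ultimately have "norm (h z - h 0) \<le> c * norm (z - 0)"
    using z by (intro field_differentiable_bound[of "ball 0 1"]) auto
  then show ?thesis
    by simp
qed

text \<open>At a zero of \<open>p\<close> itself the quotient has the junk value \<open>0\<close>; the bound is violated at
  nearby points, since the logarithmic derivative has a pole there.\<close>

lemma nonzero_of_norm_log_deriv_bounded:
  fixes p :: "complex \<Rightarrow> complex"
  assumes hol: "p holomorphic_on S" and S: "open S" "connected S" "0 \<in> S" and p0: "p 0 \<noteq> 0"
    and bound: "\<And>z. z \<in> S \<Longrightarrow> norm (z * deriv p z / p z) \<le> c"
    and z: "z \<in> S"
  shows "p z \<noteq> 0"
proof
  assume pz: "p z = 0"
  then have z0: "z \<noteq> 0"
    using p0 by auto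
  have ana: "p analytic_on {z}"
    using hol S z by (metis analytic_at)
  have "p \<midarrow>z\<rightarrow> 0"
    using analytic_at_imp_isCont[OF ana] pz by (simp add: isCont_def)
  moreover obtain r where "r > 0" "\<And>w. w \<in> ball z r - {z} \<Longrightarrow> p w \<noteq> 0"
    using isolated_zeros[OF hol S(1,2) z pz S(3) p0] by metis
  then have "\<forall>\<^sub>F w in at z. p w \<noteq> 0"
    by (auto simp: eventually_at dist_commute)
  moreover have "(\<lambda>w. p (z + w)) has_laurent_expansion laurent_expansion p z"
    using ana by (intro not_essential_has_laurent_expansion isolated_singularity_at_analytic
        not_essential_analytic)
  ultimately have "is_pole (\<lambda>w. deriv p w / p w) z"
    by (metis is_pole_deriv_divide_iff has_laurent_expansion_eventually_nonzero_iff)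
  then have "filterlim (\<lambda>w. w * (deriv p w / p w)) at_infinity (at z)"
    unfolding is_pole_def using z0
    by (intro tendsto_mult_filterlim_at_infinity) auto
  \<comment> \<open>The threshold \<open>\<bar>c\<bar> + 1\<close> is positive and exceeds
    \<open>c\<close> whatever the sign of \<open>c\<close>.\<close>
  then have "\<forall>\<^sub>F w in at z. norm (w * (deriv p w / p w)) \<ge> \<bar>c\<bar> + 1"
    by (auto simp: filterlim_at_infinity[OF order_refl])
  moreover have "\<forall>\<^sub>F w in at z. w \<in> S"
    using S z by (simp add: eventually_at_in_open')
  ultimately have "\<forall>\<^sub>F w in at z. False"
  proof eventually_elim
    case (elim w)
    then show ?case
      using bound[of w] by simp
  qed
  then show False
    by simp
qed

text \<open>From \<open>exp 1 \<le> 3\<close> follows \<open>exp (-2) \<ge> 1/9\<close>, and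
  \<open>(1 - t) / (1 + t)\<close> decreases in \<open>t\<close>, with value \<open>4/5\<close> at
  \<open>t = 1/9\<close>. Half of this is the radius \<open>2/5\<close>.\<close>

lemma tanh_1_le: "tanh (1::real) \<le> 4/5"
proof -
  have "exp (1::real) ^ 2 \<le> 3 ^ 2"
    by (intro power_mono exp_le) auto
  then have "1/9 \<le> exp (-2::real)"
    by (simp add: exp_minus exp_double[of 1, simplified] field_simps)
  then show ?thesis
    by (simp add: tanh_real_altdef add_pos_pos pos_divide_le_eq)
qed

theorem theorem4p6:
  fixes p :: "complex \<Rightarrow> complex"
  assumes "p \<in> class_H1"
    and "\<And>z. z \<in> ball 0 1 \<Longrightarrow> norm (z * deriv p z / p z) < tanh (1::real) / 2"
  shows "p \<prec>\<^sub>s cosh_sqrt"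
proof -
  have hol: "p holomorphic_on ball 0 1" and p0: "p 0 = 1"
    using assms(1) by (auto simp: class_H1_def)
  have nz: "p z \<noteq> 0" if "z \<in> ball 0 1" for z
    using nonzero_of_norm_log_deriv_bounded[OF hol open_ball connected_ball _ _ less_imp_le[OF assms(2)]]
      p0 that by auto
  obtain g where g: "g holomorphic_on ball 0 1" "\<And>z. z \<in> ball 0 1 \<Longrightarrow> p z = exp (g z)"
    using contractible_imp_holomorphic_log[OF hol _ nz] convex_imp_contractible[OF convex_ball]
    by blast
  have "deriv p z / p z = deriv g z" if z: "z \<in> ball 0 1" for z
  proof -
    have "((\<lambda>z. exp (g z)) has_field_derivative exp (g z) * deriv g z) (at z)"
      using holomorphic_derivI[OF g(1) open_ball z] by (rule DERIV_exp[THEN DERIV_chain2])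
    then have "(p has_field_derivative exp (g z) * deriv g z) (at z)"
      using has_field_derivative_transform_within_open[of _ _ z "ball 0 1" p] g(2) z by auto
    then show ?thesis
      using g(2)[OF z] by (simp add: DERIV_imp_deriv)
  qed
  then have bound: "norm (z * deriv g z) < tanh 1 / 2" if "z \<in> ball 0 1" for z
    using assms(2)[OF that] that by (metis times_divide_eq_right)
  have "p z \<in> cosh_sqrt ` ball 0 1" if z: "z \<in> ball 0 1" for z
  proof -
    \<comment> \<open>The logarithm \<open>g\<close> may take any value in \<open>2 * pi * i\<close>
      times the integers at the origin, so \<open>g z - g 0\<close> is the normalised exponent;
      \<open>exp (g 0) = 1\<close> makes the shift harmless.\<close>
    have "norm (g z - g 0) \<le> tanh 1 / 2 * norm z"
      using norm_diff_le_of_norm_times_deriv_less[OF g(1) bound z] .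
    also have "\<dots> \<le> 2/5 * norm z"
      using tanh_1_le by (intro mult_right_mono) auto
    also have "\<dots> < 2/5"
      using z by simp
    finally have "exp (g z - g 0) \<in> cosh_sqrt ` ball 0 1"
      using exp_ball_subset_cosh_sqrt_ball by auto
    moreover have "exp (g 0) = 1"
      using g(2)[of 0] p0 by simp
    ultimately show ?thesis
      using g(2)[OF z] by (simp add: exp_diff)
  qed
  then have range: "p ` ball 0 1 \<subseteq> cosh_sqrt ` ball 0 1"
    by blast
  obtain k where k: "k holomorphic_on cosh_sqrt ` ball 0 1"
    "\<And>z. z \<in> ball 0 1 \<Longrightarrow> k (cosh_sqrt z) = z"
    by (rule holomorphic_has_inverse[OF holomorphic_on_cosh_sqrt open_ball inj_on_cosh_sqrt]) metis
  have inv: "k y \<in> ball 0 1" "cosh_sqrt (k y) = y" if "y \<in> cosh_sqrt ` ball 0 1" for y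
    using that k(2) by auto
  show ?thesis
    unfolding subordinate_def
  proof (intro exI conjI)
    show "(k \<circ> p) holomorphic_on ball 0 1"
      using holomorphic_on_compose_gen[OF hol k(1) range] .
    show "(k \<circ> p) ` ball 0 1 \<subseteq> ball 0 1" "\<forall>z\<in>ball 0 1. p z = cosh_sqrt ((k \<circ> p) z)"
      using inv range by (auto simp: image_subset_iff)
    show "(k \<circ> p) 0 = 0"
      using k(2)[of 0] p0 by (simp add: cosh_sqrt_eq)
  qed
qed

end
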